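(* Let $u$ and $v$ be positive real numbers, and let $\mu(\pi)$ be the irrationality measure of $\pi$. If $\mu(\pi)< 1+\frac{u-1}{v}$, then the series $\sum_{n=1}^{\infty} \frac{1}{n^u\cdot |\sin(n)|^v}$ converges.
   Context: The irrationality measure $\mu(x)$ of a positive real number $x$ is the infimum of those $m$ for which the inequality $0 < \left|x - \frac{p}{q}\right| < \frac{1}{q^m}$ holds only for a finite number of pairs of co-prime positive integers $p$ and $q$. If no such $m$ exists, then $\mu(x) = +\infty$. *)

theory Defs
  imports Complex_Main "HOL-Library.Extended_Real"
begin

text \<open>
  The exponents range over all reals. The value lies in the extended reals, where the infimum of
  the empty set is \<open>\<infinity>\<close>.
\<close>

definition irrationality_measure :: "real \<Rightarrow> ereal" where
  "irrationality_measure x =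
     Inf (ereal ` {m :: real. finite {(p :: nat, q :: nat). p > 0 \<and> q > 0 \<and> coprime p q \<and>
        0 < \<bar>x - real p / real q\<bar> \<and> \<bar>x - real p / real q\<bar> < 1 / real q powr m}})"

end

theory Submission
  imports Defs "HOL-Analysis.Analysis" "HOL-Computational_Algebra.Primes"
begin

text \<open>
  If \<open>m\<close> is an exponent from the definition of \<open>\<mu>(\<pi>)\<close> with \<open>m < 1 + (u - 1) / v\<close>, then the distance
  from \<open>n\<close> to the nearest multiple of \<open>\<pi>\<close> is zero or at least a constant times \<open>n powr (1 - m)\<close>, and
  hence so is \<open>\<bar>sin n\<bar>\<close>. Each term of the series is therefore at most a constant times
  \<open>n powr (v * (m - 1) - u)\<close>, with an exponent below \<open>-1\<close>. The irrationality of \<open>\<pi>\<close> plays no role: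
  a term with \<open>sin n = 0\<close> would be \<open>1 / 0 = 0\<close>.
\<close>

definition close_fractions :: "real \<Rightarrow> real \<Rightarrow> (nat \<times> nat) set" where
  "close_fractions x m = {(p, q). p > 0 \<and> q > 0 \<and> coprime p q \<and>
     0 < \<bar>x - real p / real q\<bar> \<and> \<bar>x - real p / real q\<bar> < 1 / real q powr m}"

lemma irrationality_measure_lessD:
  assumes "irrationality_measure x < ereal b"
  obtains m where "finite (close_fractions x m)" "m < b"
  using assms unfolding irrationality_measure_def close_fractions_def
  by (auto simp: Inf_less_iff)

text \<open>A prime denominator \<open>q\<close> is coprime to any numerator it does not divide. A
  suitable numerator just above \<open>x * real q\<close> gives an error of at most
  \<open>2 / real q\<close>, which for \<open>m < 1\<close> is below
  \<open>1 / real q powr m\<close> once \<open>q\<close> is large. Hence exponents with finitely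
  many solutions are at least 1, so that \<open>n powr (1 - m)\<close> is nonincreasing in
  \<open>n\<close>.\<close>

lemma infinite_close_fractions:
  assumes "x \<ge> 0" "m < 1"
  shows "infinite (close_fractions x m)"
proof
  assume fin: "finite (close_fractions x m)"
  have "filterlim (\<lambda>q::nat. real q powr (1 - m)) at_top sequentially"
    using assms(2) by real_asymp
  then have "eventually (\<lambda>q::nat. real q powr (1 - m) > 2) sequentially"
    by (simp add: filterlim_at_top_dense)
  then obtain N where N: "\<And>q. q \<ge> N \<Longrightarrow> real q powr (1 - m) > 2"
    by (auto simp: eventually_sequentially)
  have "\<exists>p. (p, q) \<in> close_fractions x m" if "prime q" "q \<ge> N" for q
  proof -
    \<comment> \<open>Numerators strictly above \<open>x * real q\<close> are positive and make
      \<open>p / q\<close> differ from \<open>x\<close>.\<close>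
    define k where "k = nat \<lfloor>x * real q\<rfloor>"
    have q: "q \<ge> 2" using \<open>prime q\<close> by (rule prime_ge_2_nat)
    have k: "real k \<le> x * real q" "x * real q < real k + 1"
      unfolding k_def using assms(1) by (auto simp: of_nat_nat)
    text \<open>Two consecutive integers above \<open>x q\<close>, as one of them may be divisible by \<open>q\<close>.\<close>
    have "\<not> q dvd k + 1 \<or> \<not> q dvd k + 2"
    proof (rule ccontr)
      assume "\<not> ?thesis"
      then have "q dvd (k + 2) - (k + 1)" by (intro dvd_diff_nat) auto
      with q show False by simp
    qed
    then obtain p where p: "\<not> q dvd p" "p = k + 1 \<or> p = k + 2" by blast
    have "coprime p q"
      using p(1) \<open>prime q\<close> prime_imp_coprime coprime_commute by blast
    moreover have "real p / real q > x" "real p / real q \<le> x + 2 / real q"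
    proof -
      have "real p > x * real q" "real p \<le> x * real q + 2"
        using k p(2) by auto
      then show "real p / real q > x" "real p / real q \<le> x + 2 / real q"
        using q by (simp_all add: pos_less_divide_eq pos_divide_le_eq distrib_right)
    qed
    moreover have "2 / real q < 1 / real q powr m"
      using N[OF that(2)] q by (simp add: powr_diff field_simps)
    ultimately show ?thesis
      using p(2) q unfolding close_fractions_def by (intro exI[of _ p]) auto
  qed
  then have "q \<in> snd ` close_fractions x m" if "prime q" "q \<ge> N" for q
    using that by (metis image_eqI snd_conv)
  then have "{q. prime q} \<subseteq> {..N} \<union> snd ` close_fractions x m"
    using nat_le_linear by blast
  moreover have "finite ({..N} \<union> snd ` close_fractions x m)"
    using fin by simp
  ultimately show False
    using primes_infinite finite_subset by metis
qed

text \<open>After cancelling \<open>gcd p q\<close>, the fraction \<open>a / b\<close> is either one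
  of finitely many close ones, whose distances from \<open>x\<close> have a positive minimum, or at
  distance at least \<open>1 / real b powr m\<close>, which is no less than
  \<open>1 / real q powr m\<close> since \<open>b \<le> q\<close>. Multiplying by \<open>q\<close>
  turns the exponent \<open>- m\<close> into \<open>1 - m\<close>.\<close>

lemma linear_form_lower_bound:
  assumes fin: "finite (close_fractions x m)" and m: "m \<ge> 1"
  obtains c where "c > 0"
    "\<And>p q. \<lbrakk>p > 0; q > 0; real q * x \<noteq> real p\<rbrakk> \<Longrightarrow> c * real q powr (1 - m) \<le> \<bar>real q * x - real p\<bar>"
proof -
  \<comment> \<open>The extra element 1 keeps the minimum defined when there are no close fractions,
    and ensures \<open>c \<le> 1\<close> for the fractions that are not close.\<close>
  define D where "D = insert 1 ((\<lambda>(p, q). \<bar>x - real p / real q\<bar>) ` close_fractions x m)"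
  have finD: "finite D" "D \<noteq> {}" using fin by (auto simp: D_def)
  define c where "c = Min D"
  have c0: "c > 0"
    unfolding c_def using finD by (subst Min_gr_iff) (auto simp: D_def close_fractions_def)
  have c1: "c \<le> 1" unfolding c_def using finD by (intro Min_le) (auto simp: D_def)
  have "c * real q powr (1 - m) \<le> \<bar>real q * x - real p\<bar>"
    if pq: "p > 0" "q > 0" "real q * x \<noteq> real p" for p q
  proof -
    define g where "g = gcd p q"
    obtain a b where ab: "p = g * a" "q = g * b" "coprime a b"
      using gcd_coprime_exists[of p q] pq unfolding g_def by (auto simp: mult.commute)
    have pos: "g > 0" "a > 0" "b > 0" using pq ab by auto
    have quot: "real p / real q = real a / real b" using ab pos by simp
    have "b \<le> q" using ab pos by simp
    have dist: "\<bar>real q * x - real p\<bar> = real q * \<bar>x - real a / real b\<bar>"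
    proof -
      have "real q * x - real p = real q * (x - real p / real q)"
        using pq by (simp add: field_simps)
      then show ?thesis by (simp add: abs_mult quot)
    qed
    have nz: "\<bar>x - real a / real b\<bar> > 0" using dist pq by auto
    have "c * (1 / real q powr m) \<le> \<bar>x - real a / real b\<bar>"
    proof (cases "(a, b) \<in> close_fractions x m")
      case True
      then have "c \<le> \<bar>x - real a / real b\<bar>"
        unfolding c_def using finD by (intro Min_le) (force simp: D_def)+
      moreover have "1 / real q powr m \<le> 1"
        using m pq ge_one_powr_ge_zero[of "real q" m] by (simp add: divide_le_eq_1)
      ultimately show ?thesis
        using c0 mult_left_le[of "1 / real q powr m" c] by linarith
    next
      case False
      then have "1 / real b powr m \<le> \<bar>x - real a / real b\<bar>"
        using nz pos ab unfolding close_fractions_def by auto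
      moreover have "1 / real q powr m \<le> 1 / real b powr m"
        using \<open>b \<le> q\<close> pos m by (intro divide_left_mono powr_mono2) auto
      moreover have "c * (1 / real q powr m) \<le> 1 / real q powr m"
        using c1 by (intro mult_left_le_one_le) (use c0 in auto)
      ultimately show ?thesis by linarith
    qed
    then have "real q * (c * (1 / real q powr m)) \<le> \<bar>real q * x - real p\<bar>"
      unfolding dist by (intro mult_left_mono) auto
    moreover have "real q * (c * (1 / real q powr m)) = c * real q powr (1 - m)"
      using pq by (simp add: powr_diff)
    ultimately show ?thesis by simp
  qed
  then show thesis using c0 that by blast
qed

text \<open>By Taylor's bound, \<open>sin t\<close> differs from \<open>t\<close> by at most |t|^3 /
  6, and this is at most |t| / 2 because t^2 \<le> 3 on this interval.\<close>

lemma abs_sin_ge_half: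
  fixes t :: real
  assumes "\<bar>t\<bar> \<le> pi / 2"
  shows "\<bar>t\<bar> / 2 \<le> \<bar>sin t\<bar>"
proof -
  \<comment> \<open>1.6 lies just above pi / 2, and its square 2.56 is below 3.\<close>
  have "\<bar>t\<bar> \<le> 1.6" using assms pi_approx by simp
  then have "\<bar>t\<bar>\<^sup>2 \<le> 1.6\<^sup>2" by (intro power_mono) auto
  then have "\<bar>t\<bar> * \<bar>t\<bar>\<^sup>2 \<le> \<bar>t\<bar> * 3" by (intro mult_left_mono) (auto simp: power2_eq_square)
  then have "\<bar>t\<bar> ^ 3 \<le> 3 * \<bar>t\<bar>" by (simp add: power3_eq_cube power2_eq_square)
  moreover have "\<bar>sin t - t\<bar> \<le> \<bar>t\<bar> ^ 3 / 6"
    using Maclaurin_sin_bound[of t 3] by (simp add: numeral_3_eq_3 sin_coeff_def)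
  ultimately show ?thesis by linarith
qed

text \<open>The linear form is taken with \<open>n\<close> as numerator and the integer
  \<open>q\<close> nearest to n / pi as denominator. Up to sign, \<open>sin n\<close> is the sine of
  \<open>n - q * pi\<close>, an argument small enough for the sine to be comparable to it.\<close>

lemma abs_sin_lower_bound:
  assumes "finite (close_fractions pi m)" and m: "m \<ge> 1"
  obtains c where "c > 0"
    "\<And>n::nat. \<lbrakk>n \<ge> 2; sin (real n) \<noteq> 0\<rbrakk> \<Longrightarrow> c * real n powr (1 - m) \<le> \<bar>sin (real n)\<bar>"
proof -
  obtain c where c: "c > 0"
    "\<And>p q. \<lbrakk>p > 0; q > 0; real q * pi \<noteq> real p\<rbrakk>
       \<Longrightarrow> c * real q powr (1 - m) \<le> \<bar>real q * pi - real p\<bar>"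
    using linear_form_lower_bound[OF assms] by blast
  have "c / 2 * real n powr (1 - m) \<le> \<bar>sin (real n)\<bar>"
    if n: "n \<ge> 2" "sin (real n) \<noteq> 0" for n :: nat
  proof -
    define q where "q = nat (round (real n / pi))"
    have "round (real n / pi) \<ge> 0"
      by (metis divide_nonneg_pos of_nat_0_le_iff pi_gt_zero round_0 round_mono)
    then have "real q = of_int (round (real n / pi))" by (simp add: q_def)
    then have near: "\<bar>real q - real n / pi\<bar> \<le> 1 / 2"
      using of_int_round_abs_le[of "real n / pi"] by simp
    \<comment> \<open>Here \<open>n \<ge> 2\<close> matters: 1 / pi rounds to 0, whereas 2 / pi
      exceeds 1 / 2.\<close>
    have "real n / pi > 1 / 2" using n pi_less_4 by (simp add: field_simps)
    then have q: "q > 0" using near by (cases "q = 0") auto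
    \<comment> \<open>Since \<open>q \<le> n\<close> and \<open>1 - m \<le> 0\<close>, the bound in
      terms of \<open>q\<close> will pass to one in terms of \<open>n\<close>.\<close>
    have "real n / pi \<le> real n / 2" using pi_gt3 by (intro divide_left_mono) auto
    then have "q \<le> n" using near n by linarith
    define t where "t = real n - real q * pi"
    have "\<bar>t\<bar> = \<bar>real q - real n / pi\<bar> * pi"
      by (simp add: t_def abs_mult_pos left_diff_distrib)
    also have "\<dots> \<le> 1 / 2 * pi" using near by (intro mult_right_mono) auto
    finally have t: "\<bar>t\<bar> \<le> pi / 2" by simp
    have sin: "\<bar>sin (real n)\<bar> = \<bar>sin t\<bar>"
      by (simp add: t_def sin_diff abs_mult cos_npi)
    have "real q * pi \<noteq> real n" using n(2) sin_npi[of q] by metis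
    then have "c * real q powr (1 - m) \<le> \<bar>real q * pi - real n\<bar>"
      using c(2)[of n q] n(1) q by simp
    moreover have "c * real n powr (1 - m) \<le> c * real q powr (1 - m)"
      using c(1) m q \<open>q \<le> n\<close> by (intro mult_left_mono powr_mono2') auto
    ultimately have "c * real n powr (1 - m) \<le> \<bar>t\<bar>" by (simp add: t_def)
    then show ?thesis using abs_sin_ge_half[OF t] sin by simp
  qed
  then show thesis using c(1) that[of "c / 2"] by simp
qed

theorem theorem5:
  fixes u v :: real
  assumes "u > 0" and "v > 0"
    and "irrationality_measure pi < ereal (1 + (u - 1) / v)"
  shows "summable (\<lambda>n. 1 / (real (Suc n) powr u * \<bar>sin (real (Suc n))\<bar> powr v))"
proof -
  obtain m where m: "finite (close_fractions pi m)" "m < 1 + (u - 1) / v"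
    using irrationality_measure_lessD[OF assms(3)] .
  then have "m \<ge> 1" using infinite_close_fractions[of pi m] by force
  then obtain c where c: "c > 0"
    "\<And>n::nat. \<lbrakk>n \<ge> 2; sin (real n) \<noteq> 0\<rbrakk> \<Longrightarrow> c * real n powr (1 - m) \<le> \<bar>sin (real n)\<bar>"
    using abs_sin_lower_bound[OF m(1)] by blast
  \<comment> \<open>The exponent of \<open>n\<close> in the majorant, once the lower bound for the
    sine is raised to the power \<open>v\<close>. That it is below -1 is the upper bound on
    \<open>m\<close> multiplied by \<open>v\<close>.\<close>
  define e where "e = - (u + (1 - m) * v)"
  have "e < -1" using m(2) assms(2) by (simp add: e_def field_simps)
  then have "summable (\<lambda>n. c powr (-v) * real n powr e)"
    by (simp add: summable_mult summable_real_powr_iff)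
  moreover have "norm (1 / (real n powr u * \<bar>sin (real n)\<bar> powr v)) \<le> c powr (-v) * real n powr e"
    if n: "n \<ge> 2" for n :: nat
  proof (cases "sin (real n) = 0")
    case False
    have "c powr v * real n powr ((1 - m) * v) = (c * real n powr (1 - m)) powr v"
      using c(1) by (simp add: powr_mult powr_powr)
    also have "\<dots> \<le> \<bar>sin (real n)\<bar> powr v"
      using c n False assms(2) by (intro powr_mono2) auto
    finally have "1 / (real n powr u * \<bar>sin (real n)\<bar> powr v)
        \<le> 1 / (real n powr u * (c powr v * real n powr ((1 - m) * v)))"
      using c(1) n False by (intro divide_left_mono mult_left_mono mult_pos_pos) auto
    also have "\<dots> = c powr (-v) * real n powr e"
      unfolding e_def by (simp only: powr_minus powr_add) (simp add: divide_inverse)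
    finally show ?thesis by simp
  qed simp
  \<comment> \<open>The comparison starts at index 2; the shift to \<open>Suc n\<close> afterwards
    drops the term at index 0.\<close>
  ultimately have "summable (\<lambda>n. 1 / (real n powr u * \<bar>sin (real n)\<bar> powr v))"
    by (rule summable_comparison_test'[where N = 2])
  then show ?thesis
    using summable_Suc_iff[of "\<lambda>n. 1 / (real n powr u * \<bar>sin (real n)\<bar> powr v)"] by blast
qed

end
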